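(* Let $\mathcal{F}$ be a Furstenberg family, let $\mathbb{D}$ be the open unit disk of $\mathbb{C}$, let $N\geq 2$, and let $\phi_1,\dots,\phi_N:\mathbb{D}\to\mathbb{D}$ be holomorphic self-maps of $\mathbb{D}$. Then the following assertions are equivalent: (1) The composition operators $C_{\phi_1},\dots,C_{\phi_N}$ on $H(\mathbb{D})$ are disjoint $\mathcal{F}$-transitive. (2) (a) Each of $\phi_1,\dots,\phi_N$ is injective, and (b) for every compact subset $K$ of $\mathbb{D}$, $$\{n\in \mathbb{N}:\ K,\phi_{1,n}(K),\dots,\phi_{N,n}(K)\text{ are pairwise disjoint}\}\in \mathcal{F}.$$
   Context: $\mathbb{N}$ denotes the set of positive integers. A Furstenberg family is a non-empty collection $\mathcal{F}$ of subsets of $\mathbb{N}$ such that $\emptyset\notin\mathcal{F}$ and, if $A\in\mathcal{F}$ and $A\subset B\subset\mathbb{N}$, then $B\in\mathcal{F}$. $H(\mathbb{D})$ is the space of holomorphic functions on $\mathbb{D}$ with the topology of uniform convergence on compact subsets. For a holomorphic self-map $\phi$ of $\mathbb{D}$, $C_\phi:H(\mathbb{D})\to H(\mathbb{D})$ is $C_\phi(f)=f\circ\phi$. $\phi_{i,n}$ denotes the $n$-th iterate $\phi_i\circ\dots\circ\phi_i$ ($n$ times). Continuous linear operators $T_1,\dots,T_N$ on a topological vector space $X$ are disjoint $\mathcal{F}$-transitive if for all non-empty open subsets $U_0,\dots,U_N$ of $X$ the set $\{n\in\mathbb{N}:\ U_0\cap T_1^{-n}(U_1)\cap\dots\cap T_N^{-n}(U_N)\neq\emptyset\}$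 belongs to $\mathcal{F}$, where $T_i^{-n}(U_i)$ is the preimage of $U_i$ under $T_i^n$. *)

theory Defs
  imports "HOL-Complex_Analysis.Complex_Analysis"
begin

text \<open>The positive integers are the subset \<open>{1..}\<close> of \<^typ>\<open>nat\<close>.\<close>

definition furstenberg_family :: "nat set set \<Rightarrow> bool" where
  "furstenberg_family \<F> \<longleftrightarrow>
     \<F> \<noteq> {} \<and> \<F> \<subseteq> Pow {1..} \<and> {} \<notin> \<F> \<and>
     (\<forall>A B. A \<in> \<F> \<and> A \<subseteq> B \<and> B \<subseteq> {1..} \<longrightarrow> B \<in> \<F>)"

text \<open>Continuity and linearity of the operators are not part of this predicate; they are
  properties of the operators to which it is applied. For composition operators see
  \<open>continuous_map_comp_op\<close>, \<open>comp_op_add\<close> and \<open>comp_op_scale\<close> below.\<close>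

definition disjoint_transitive ::
    "nat set set \<Rightarrow> 'a topology \<Rightarrow> nat \<Rightarrow> (nat \<Rightarrow> 'a \<Rightarrow> 'a) \<Rightarrow> bool" where
  "disjoint_transitive \<F> X N T \<longleftrightarrow>
     (\<forall>U :: nat \<Rightarrow> 'a set. (\<forall>i\<in>{0..N}. openin X (U i) \<and> U i \<noteq> {}) \<longrightarrow>
        {n \<in> {1..}. U 0 \<inter> (\<Inter>i\<in>{1..N}. {x \<in> topspace X. (T i ^^ n) x \<in> U i}) \<noteq> {}} \<in> \<F>)"

abbreviation unit_disc :: "complex set" where
  "unit_disc \<equiv> ball 0 1"

text \<open>HOL functions are total, so a function on the disc is represented by its unique extension
  by \<open>0\<close>. This makes the representation injective and closed under the pointwise
  vector space operations.\<close>

definition hol_disc :: "(complex \<Rightarrow> complex) set" where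
  "hol_disc = {f. f holomorphic_on unit_disc \<and> (\<forall>z. z \<notin> unit_disc \<longrightarrow> f z = 0)}"

definition hol_disc_topology :: "(complex \<Rightarrow> complex) topology" where
  "hol_disc_topology = topology (\<lambda>U. U \<subseteq> hol_disc \<and>
     (\<forall>f\<in>U. \<exists>K e. compact K \<and> K \<subseteq> unit_disc \<and> e > 0 \<and>
        {g \<in> hol_disc. \<forall>z\<in>K. dist (g z) (f z) < e} \<subseteq> U))"

definition comp_op :: "(complex \<Rightarrow> complex) \<Rightarrow> (complex \<Rightarrow> complex) \<Rightarrow> complex \<Rightarrow> complex" where
  "comp_op \<phi> f = (\<lambda>z. if z \<in> unit_disc then f (\<phi> z) else 0)"

lemma openin_hol_disc:
  "openin hol_disc_topology U \<longleftrightarrow> U \<subseteq> hol_disc \<and>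
     (\<forall>f\<in>U. \<exists>K e. compact K \<and> K \<subseteq> unit_disc \<and> e > 0 \<and>
        {g \<in> hol_disc. \<forall>z\<in>K. dist (g z) (f z) < e} \<subseteq> U)"
proof -
  let ?P = "\<lambda>U. U \<subseteq> hol_disc \<and>
     (\<forall>f\<in>U. \<exists>K e. compact K \<and> K \<subseteq> unit_disc \<and> e > 0 \<and>
        {g \<in> hol_disc. \<forall>z\<in>K. dist (g z) (f z) < e} \<subseteq> U)"
  have "istopology ?P"
    unfolding istopology_def
  proof (intro conjI allI impI)
    fix S T assume S: "?P S" and T: "?P T"
    show "S \<inter> T \<subseteq> hol_disc" using S by blast
    show "\<forall>f\<in>S \<inter> T. \<exists>K e. compact K \<and> K \<subseteq> unit_disc \<and> e > 0 \<and>
        {g \<in> hol_disc. \<forall>z\<in>K. dist (g z) (f z) < e} \<subseteq> S \<inter> T"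
    proof
      fix f assume f: "f \<in> S \<inter> T"
      obtain K e where K: "compact K" "K \<subseteq> unit_disc" "e > 0"
        "{g \<in> hol_disc. \<forall>z\<in>K. dist (g z) (f z) < e} \<subseteq> S" using S f by blast
      obtain L d where L: "compact L" "L \<subseteq> unit_disc" "d > 0"
        "{g \<in> hol_disc. \<forall>z\<in>L. dist (g z) (f z) < d} \<subseteq> T" using T f by blast
      have "compact (K \<union> L)" using K(1) L(1) by (rule compact_Un)
      moreover have "K \<union> L \<subseteq> unit_disc" using K(2) L(2) by (rule Un_least)
      moreover have "min e d > 0" using K(3) L(3) by simp
      moreover have "{g \<in> hol_disc. \<forall>z\<in>K \<union> L. dist (g z) (f z) < min e d} \<subseteq> S \<inter> T"
      proof (rule subset_trans[OF _ Int_mono[OF K(4) L(4)]], intro subsetI)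
        fix g assume "g \<in> {g \<in> hol_disc. \<forall>z\<in>K \<union> L. dist (g z) (f z) < min e d}"
        then show "g \<in> {g \<in> hol_disc. \<forall>z\<in>K. dist (g z) (f z) < e} \<inter>
            {g \<in> hol_disc. \<forall>z\<in>L. dist (g z) (f z) < d}" by simp
      qed
      ultimately show "\<exists>K e. compact K \<and> K \<subseteq> unit_disc \<and> e > 0 \<and>
        {g \<in> hol_disc. \<forall>z\<in>K. dist (g z) (f z) < e} \<subseteq> S \<inter> T" by blast
    qed
  next
    fix \<K> assume K: "\<forall>K\<in>\<K>. ?P K"
    show "\<Union>\<K> \<subseteq> hol_disc" using K by blast
    show "\<forall>f\<in>\<Union>\<K>. \<exists>K e. compact K \<and> K \<subseteq> unit_disc \<and> e > 0 \<and>
        {g \<in> hol_disc. \<forall>z\<in>K. dist (g z) (f z) < e} \<subseteq> \<Union>\<K>"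
    proof
      fix f assume "f \<in> \<Union>\<K>"
      then obtain S where S: "S \<in> \<K>" "f \<in> S" by blast
      have "?P S" using K S(1) by (rule bspec)
      then obtain L e where L: "compact L" "L \<subseteq> unit_disc" "e > 0"
        "{g \<in> hol_disc. \<forall>z\<in>L. dist (g z) (f z) < e} \<subseteq> S" using S(2) by blast
      have "S \<subseteq> \<Union>\<K>" using S(1) by (rule Union_upper)
      then have "{g \<in> hol_disc. \<forall>z\<in>L. dist (g z) (f z) < e} \<subseteq> \<Union>\<K>"
        by (rule subset_trans[OF L(4)])
      with L(1-3) show "\<exists>K e. compact K \<and> K \<subseteq> unit_disc \<and> e > 0 \<and>
        {g \<in> hol_disc. \<forall>z\<in>K. dist (g z) (f z) < e} \<subseteq> \<Union>\<K>"
        by (intro exI[of _ L] exI[of _ e] conjI)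
    qed
  qed
  then show ?thesis
    unfolding hol_disc_topology_def by (simp only: topology_inverse')
qed

lemma topspace_hol_disc [simp]: "topspace hol_disc_topology = hol_disc"
proof
  show "topspace hol_disc_topology \<subseteq> hol_disc"
    using openin_topspace[of hol_disc_topology] unfolding openin_hol_disc by (rule conjunct1)
  have "openin hol_disc_topology hol_disc"
    unfolding openin_hol_disc
  proof (intro conjI ballI subset_refl)
    fix f :: "complex \<Rightarrow> complex"
    have "compact {} \<and> {} \<subseteq> unit_disc \<and> (1::real) > 0 \<and>
        {g \<in> hol_disc. \<forall>z\<in>{}. dist (g z) (f z) < 1} \<subseteq> hol_disc" by simp
    then show "\<exists>K e. compact K \<and> K \<subseteq> unit_disc \<and> e > 0 \<and>
        {g \<in> hol_disc. \<forall>z\<in>K. dist (g z) (f z) < e} \<subseteq> hol_disc" by blast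
  qed
  then show "hol_disc \<subseteq> topspace hol_disc_topology" by (rule openin_subset)
qed

text \<open>Convergence in this topology is uniform convergence on compact subsets.\<close>

lemma limitin_hol_disc:
  assumes "\<forall>\<^sub>F x in F. f x \<in> hol_disc" and "l \<in> hol_disc"
  shows "limitin hol_disc_topology f l F \<longleftrightarrow>
    (\<forall>K. compact K \<and> K \<subseteq> unit_disc \<longrightarrow> uniform_limit K f l F)"
proof (intro iffI allI impI)
  fix K assume lim: "limitin hol_disc_topology f l F" and K: "compact K \<and> K \<subseteq> unit_disc"
  show "uniform_limit K f l F"
  proof (rule uniform_limitI)
    fix e :: real assume e: "e > 0"
    let ?U = "{g \<in> hol_disc. \<exists>d<e. \<forall>z\<in>K. dist (g z) (l z) \<le> d}"
    have "openin hol_disc_topology ?U"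
      unfolding openin_hol_disc
    proof (intro conjI ballI)
      fix g assume "g \<in> ?U"
      then obtain d where d: "d < e" "\<forall>z\<in>K. dist (g z) (l z) \<le> d" by blast
      have "{h \<in> hol_disc. \<forall>z\<in>K. dist (h z) (g z) < (e - d) / 2} \<subseteq> ?U"
      proof clarify
        fix h assume h: "h \<in> hol_disc" "\<forall>z\<in>K. dist (h z) (g z) < (e - d) / 2"
        have "dist (h z) (l z) \<le> (e + d) / 2" if "z \<in> K" for z
        proof -
          have "dist (h z) (l z) \<le> dist (h z) (g z) + dist (g z) (l z)"
            by (rule dist_triangle)
          moreover have "dist (h z) (g z) < (e - d) / 2" "dist (g z) (l z) \<le> d"
            using h d that by auto
          ultimately show ?thesis by argo
        qed
        moreover have "(e + d) / 2 < e" using d by simp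
        ultimately show "\<exists>d<e. \<forall>z\<in>K. dist (h z) (l z) \<le> d" by blast
      qed
      moreover have "(e - d) / 2 > 0" using d by simp
      ultimately show "\<exists>K' d. compact K' \<and> K' \<subseteq> unit_disc \<and> d > 0 \<and>
          {h \<in> hol_disc. \<forall>z\<in>K'. dist (h z) (g z) < d} \<subseteq> ?U"
        using K by blast
    qed auto
    moreover have "l \<in> ?U" using assms e by auto
    ultimately have "\<forall>\<^sub>F x in F. f x \<in> ?U" using lim unfolding limitin_def by blast
    then show "\<forall>\<^sub>F x in F. \<forall>z\<in>K. dist (f x z) (l z) < e"
      by (rule eventually_mono) force
  qed
next
  assume unif: "\<forall>K. compact K \<and> K \<subseteq> unit_disc \<longrightarrow> uniform_limit K f l F"
  show "limitin hol_disc_topology f l F"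
    unfolding limitin_def
  proof (intro conjI allI impI)
    show "l \<in> topspace hol_disc_topology" using assms by simp
    fix U assume U: "openin hol_disc_topology U \<and> l \<in> U"
    then obtain K e where K: "compact K" "K \<subseteq> unit_disc" "e > 0"
      "{g \<in> hol_disc. \<forall>z\<in>K. dist (g z) (l z) < e} \<subseteq> U"
      unfolding openin_hol_disc by blast
    then have "uniform_limit K f l F" using unif by blast
    then have "\<forall>\<^sub>F x in F. \<forall>z\<in>K. dist (f x z) (l z) < e"
      using K(3) by (rule uniform_limitD)
    with assms(1) show "\<forall>\<^sub>F x in F. f x \<in> U"
      by eventually_elim (use K(4) in blast)
  qed
qed

lemma comp_op_in_hol_disc:
  assumes "\<phi> holomorphic_on unit_disc" "\<phi> ` unit_disc \<subseteq> unit_disc" "f \<in> hol_disc"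
  shows "comp_op \<phi> f \<in> hol_disc"
proof -
  have "(f \<circ> \<phi>) holomorphic_on unit_disc"
    using assms by (intro holomorphic_on_compose_gen[of _ _ f unit_disc]) (auto simp: hol_disc_def)
  then have "comp_op \<phi> f holomorphic_on unit_disc"
    by (rule holomorphic_transform) (auto simp: comp_op_def)
  then show ?thesis by (auto simp: hol_disc_def comp_op_def)
qed

lemma continuous_map_comp_op:
  assumes "\<phi> holomorphic_on unit_disc" "\<phi> ` unit_disc \<subseteq> unit_disc"
  shows "continuous_map hol_disc_topology hol_disc_topology (comp_op \<phi>)"
  unfolding continuous_map
proof (intro conjI allI impI)
  show "comp_op \<phi> ` topspace hol_disc_topology \<subseteq> topspace hol_disc_topology"
    using comp_op_in_hol_disc[OF assms] by auto
  fix U assume U: "openin hol_disc_topology U"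
  let ?V = "{f \<in> topspace hol_disc_topology. comp_op \<phi> f \<in> U}"
  show "openin hol_disc_topology ?V"
    unfolding openin_hol_disc
  proof (intro conjI ballI)
    show "?V \<subseteq> hol_disc" by auto
    fix f assume f: "f \<in> ?V"
    then obtain K e where K: "compact K" "K \<subseteq> unit_disc" "e > 0"
      "{g \<in> hol_disc. \<forall>z\<in>K. dist (g z) (comp_op \<phi> f z) < e} \<subseteq> U"
      using U unfolding openin_hol_disc by blast
    have "continuous_on K \<phi>"
      using assms(1) K(2) continuous_on_subset holomorphic_on_imp_continuous_on by blast
    then have "compact (\<phi> ` K)" using K(1) by (rule compact_continuous_image)
    moreover have "\<phi> ` K \<subseteq> unit_disc" using assms(2) K(2) by blast
    moreover have "{g \<in> hol_disc. \<forall>z\<in>\<phi> ` K. dist (g z) (f z) < e} \<subseteq> ?V"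
    proof clarify
      fix g assume g: "g \<in> hol_disc" "\<forall>z\<in>\<phi> ` K. dist (g z) (f z) < e"
      have "\<forall>z\<in>K. dist (comp_op \<phi> g z) (comp_op \<phi> f z) < e"
        using g K(2) by (auto simp: comp_op_def)
      then have "comp_op \<phi> g \<in> U"
        using K(4) comp_op_in_hol_disc[OF assms g(1)] by blast
      then show "g \<in> topspace hol_disc_topology \<and> comp_op \<phi> g \<in> U" using g by simp
    qed
    ultimately show "\<exists>K e. compact K \<and> K \<subseteq> unit_disc \<and> e > 0 \<and>
        {g \<in> hol_disc. \<forall>z\<in>K. dist (g z) (f z) < e} \<subseteq> ?V"
      using K(3) by blast
  qed
qed

lemma comp_op_add: "comp_op \<phi> (\<lambda>z. f z + g z) = (\<lambda>z. comp_op \<phi> f z + comp_op \<phi> g z)"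
  by (auto simp: comp_op_def)

lemma comp_op_scale: "comp_op \<phi> (\<lambda>z. c * f z) = (\<lambda>z. c * comp_op \<phi> f z)"
  by (auto simp: comp_op_def)

end

theory Submission
  imports Defs
begin

text \<open>Transitivity forces disjointness by approximating the distinct constants \<open>0, \<dots>, N\<close> on \<open>K\<close>,
  and injectivity by approximating the identity at two points that \<open>\<phi> i\<close> would identify.
  Conversely, for radii \<open>r < s < 1\<close> let the sets \<open>\<psi> i ` cball 0 s\<close> be pairwise disjoint, where
  \<open>\<psi> 0 = id\<close> and \<open>\<psi> i = \<phi> i ^^ n\<close>. It suffices to find an entire function that is uniformly close
  on each \<open>\<psi> i ` cball 0 r\<close> to \<open>h i\<close> composed with the inverse of \<open>\<psi> i\<close>. This is Runge's theorem
  for the union \<open>L\<close> of these sets, whose complement is connected by Janiszewski's theorem. The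
  Cauchy integral of the target over the curve \<open>\<psi> i (s e\<^sup>i\<^sup>t)\<close> reproduces it on the \<open>i\<close>-th piece and
  vanishes on the other pieces, its Riemann sums are combinations of functions \<open>1 / (w - z)\<close>
  with \<open>w \<notin> L\<close>, and such poles can be pushed to infinity.\<close>

section \<open>Uniform approximation by entire functions\<close>

text \<open>On a compact \<open>L\<close> polynomials would give the same class; entire functions
  spare the truncation of Taylor series and restrict directly to the disc.\<close>

definition entire_approximable :: "complex set \<Rightarrow> (complex \<Rightarrow> complex) \<Rightarrow> bool" where
  "entire_approximable L f \<longleftrightarrow>
     (\<forall>e>0. \<exists>p. p holomorphic_on UNIV \<and> (\<forall>z\<in>L. dist (p z) (f z) < e))"

lemma entire_approximable_holomorphic: "p holomorphic_on UNIV \<Longrightarrow> entire_approximable L p"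
  unfolding entire_approximable_def by auto

lemma entire_approximable_cong:
  "entire_approximable L f \<Longrightarrow> (\<And>z. z \<in> L \<Longrightarrow> f z = g z) \<Longrightarrow> entire_approximable L g"
  unfolding entire_approximable_def by fastforce

text \<open>The bound is inherited from an entire function at distance below 1 from
  \<open>f\<close>, which is continuous on the compact set \<open>L\<close>.\<close>

lemma entire_approximable_bounded:
  assumes "entire_approximable L f" "compact L"
  obtains B where "B > 0" "\<And>z. z \<in> L \<Longrightarrow> norm (f z) \<le> B"
proof -
  obtain p where p: "p holomorphic_on UNIV" "\<And>z. z \<in> L \<Longrightarrow> dist (p z) (f z) < 1"
    using assms(1) zero_less_one unfolding entire_approximable_def by blast
  have "compact (p ` L)"
    using p(1) assms(2)
    by (meson compact_continuous_image continuous_on_subset holomorphic_on_imp_continuous_on subset_UNIV)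
  then obtain B where B: "B > 0" "\<And>z. z \<in> L \<Longrightarrow> norm (p z) \<le> B"
    by (metis bounded_pos compact_imp_bounded imageI)
  have "norm (f z) \<le> B + 1" if "z \<in> L" for z
  proof -
    have "norm (f z) \<le> norm (p z) + norm (f z - p z)"
      by (rule norm_triangle_sub)
    then show ?thesis
      using p(2)[OF that] B(2)[OF that] by (simp add: dist_norm norm_minus_commute)
  qed
  then show ?thesis
    using that[of "B + 1"] B(1) by simp
qed

lemma entire_approximable_limit:
  assumes "\<And>e. e > 0 \<Longrightarrow> \<exists>g. entire_approximable L g \<and> (\<forall>z\<in>L. dist (g z) (f z) < e)"
  shows "entire_approximable L f"
  unfolding entire_approximable_def
proof (intro allI impI)
  fix e :: real assume "e > 0"
  then have e: "e / 2 > 0" by simp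
  obtain g where g: "entire_approximable L g" "\<forall>z\<in>L. dist (g z) (f z) < e / 2"
    using assms[OF e] by blast
  obtain p where p: "p holomorphic_on UNIV" "\<forall>z\<in>L. dist (p z) (g z) < e / 2"
    using g(1) e unfolding entire_approximable_def by blast
  have "dist (p z) (f z) < e" if "z \<in> L" for z
    using g(2) p(2) that dist_triangle_half_r[of "g z" "p z" e "f z"] by (simp add: dist_commute)
  with p(1) show "\<exists>p. p holomorphic_on UNIV \<and> (\<forall>z\<in>L. dist (p z) (f z) < e)" by blast
qed

lemma entire_approximable_add:
  assumes "entire_approximable L f" "entire_approximable L g"
  shows "entire_approximable L (\<lambda>z. f z + g z)"
  unfolding entire_approximable_def
proof (intro allI impI)
  fix e :: real assume "e > 0"
  then have e: "e / 2 > 0" by simp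
  obtain p q where p: "p holomorphic_on UNIV" "\<forall>z\<in>L. dist (p z) (f z) < e / 2"
    and q: "q holomorphic_on UNIV" "\<forall>z\<in>L. dist (q z) (g z) < e / 2"
    using assms e unfolding entire_approximable_def by meson
  have "(\<lambda>z. p z + q z) holomorphic_on UNIV"
    using p(1) q(1) by (rule holomorphic_on_add)
  moreover have "dist (p z + q z) (f z + g z) < e" if "z \<in> L" for z
    using p(2) q(2) that dist_triangle_add[of "p z" "q z" "f z" "g z"] by fastforce
  ultimately show "\<exists>p. p holomorphic_on UNIV \<and> (\<forall>z\<in>L. dist (p z) (f z + g z) < e)"
    by (intro exI[of _ "\<lambda>z. p z + q z"]) simp
qed

lemma entire_approximable_mult:
  assumes "compact L" "entire_approximable L f" "entire_approximable L g"
  shows "entire_approximable L (\<lambda>z. f z * g z)"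
  unfolding entire_approximable_def
proof (intro allI impI)
  fix e :: real assume e: "e > 0"
  obtain B where B: "B > 0" "\<And>z. z \<in> L \<Longrightarrow> norm (f z) \<le> B"
    using entire_approximable_bounded assms by blast
  \<comment> \<open>The splitting \<open>(p - f) * q + f * (q - g)\<close> fixes the order of
    choices: \<open>q\<close> depends on the bound for \<open>f\<close>, and \<open>p\<close> on the
    bound for the chosen \<open>q\<close>.\<close>
  have "e / (2 * B) > 0" using e B by simp
  then obtain q where q: "q holomorphic_on UNIV" "\<forall>z\<in>L. dist (q z) (g z) < e / (2 * B)"
    using assms(3) unfolding entire_approximable_def by blast
  obtain C where C: "C > 0" "\<And>z. z \<in> L \<Longrightarrow> norm (q z) \<le> C"
    using entire_approximable_bounded[OF entire_approximable_holomorphic[OF q(1)] assms(1)] by blast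
  have "e / (2 * C) > 0" using e C by simp
  then obtain p where p: "p holomorphic_on UNIV" "\<forall>z\<in>L. dist (p z) (f z) < e / (2 * C)"
    using assms(2) unfolding entire_approximable_def by blast
  have "dist (p z * q z) (f z * g z) < e" if "z \<in> L" for z
  proof -
    have "p z * q z - f z * g z = (p z - f z) * q z + f z * (q z - g z)"
      by (simp add: algebra_simps)
    then have "norm (p z * q z - f z * g z) \<le> norm (p z - f z) * norm (q z) + norm (f z) * norm (q z - g z)"
      by (metis norm_mult norm_triangle_ineq)
    also have "\<dots> \<le> norm (p z - f z) * C + B * norm (q z - g z)"
      using B C that by (intro add_mono mult_left_mono mult_right_mono) auto
    also have "\<dots> < e / (2 * C) * C + B * (e / (2 * B))"
      using B C that p(2) q(2)
      by (intro add_strict_mono mult_strict_right_mono mult_strict_left_mono) (auto simp: dist_norm)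
    also have "\<dots> = e" using B C by simp
    finally show ?thesis by (simp add: dist_norm)
  qed
  moreover have "(\<lambda>z. p z * q z) holomorphic_on UNIV"
    using p(1) q(1) by (rule holomorphic_on_mult)
  ultimately show "\<exists>p. p holomorphic_on UNIV \<and> (\<forall>z\<in>L. dist (p z) (f z * g z) < e)"
    by (intro exI[of _ "\<lambda>z. p z * q z"]) simp
qed

lemma entire_approximable_const: "entire_approximable L (\<lambda>z. c)"
  by (intro entire_approximable_holomorphic holomorphic_intros)

lemma entire_approximable_cmult:
  assumes "compact L" "entire_approximable L f"
  shows "entire_approximable L (\<lambda>z. c * f z)"
  using entire_approximable_mult[OF assms(1) entire_approximable_const assms(2)] .

lemma entire_approximable_sum:
  "(\<And>i. i \<in> I \<Longrightarrow> entire_approximable L (f i)) \<Longrightarrow> entire_approximable L (\<lambda>z. \<Sum>i\<in>I. f i z)"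
  by (induction I rule: infinite_finite_induct)
     (auto intro: entire_approximable_const entire_approximable_add)

lemma entire_approximable_power:
  assumes "compact L" "entire_approximable L f"
  shows "entire_approximable L (\<lambda>z. f z ^ n)"
  by (induction n) (use assms in \<open>auto intro: entire_approximable_const entire_approximable_mult\<close>)

section \<open>Geometric series and pole pushing\<close>

text \<open>The partial sums of the geometric series stay in the class and converge uniformly,
  because a single \<open>q < 1\<close> bounds the ratio on all of \<open>L\<close>.\<close>

lemma entire_approximable_geometric:
  assumes "compact L" "entire_approximable L a" "q < 1" "\<And>z. z \<in> L \<Longrightarrow> norm (a z) \<le> q"
  shows "entire_approximable L (\<lambda>z. 1 / (1 - a z))"
\<comment> \<open>Only a point of \<open>L\<close> forces \<open>q \<ge> 0\<close>; for a negative
  \<open>q\<close> the powers \<open>q ^ n\<close> need not tend to 0.\<close>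
proof (cases "L = {}")
  case True
  then show ?thesis by (auto simp: entire_approximable_def intro: holomorphic_on_const)
next
  case False
  then have q0: "q \<ge> 0"
    using assms(4) norm_ge_zero order_trans by blast
  show ?thesis
  proof (rule entire_approximable_limit)
    fix e :: real assume e: "e > 0"
    have "(\<lambda>n. q ^ n) \<longlonglongrightarrow> 0"
      using q0 assms(3) by (intro LIMSEQ_power_zero) auto
    \<comment> \<open>The remainder after \<open>n\<close> terms is at most
      \<open>q ^ n / (1 - q)\<close>, hence the threshold \<open>e * (1 - q)\<close> for
      \<open>q ^ n\<close>.\<close>
    moreover have "e * (1 - q) > 0" using e assms(3) by simp
    ultimately have "\<forall>\<^sub>F n in sequentially. q ^ n < e * (1 - q)"
      by (rule order_tendstoD(2))
    then obtain n where n: "q ^ n < e * (1 - q)"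
      by (auto simp: eventually_sequentially)
    have "dist (\<Sum>k<n. a z ^ k) (1 / (1 - a z)) < e" if z: "z \<in> L" for z
    proof -
      have nq: "norm (a z) \<le> q" using assms(4) z by blast
      then have a1: "a z \<noteq> 1" using assms(3) by auto
      have "1 - q \<le> norm (1 - a z)"
        using nq norm_triangle_ineq2[of 1 "a z"] by simp
      have "(\<Sum>k<n. a z ^ k) = (1 - a z ^ n) / (1 - a z)"
        using a1 by (simp add: sum_gp_strict)
      then have "(\<Sum>k<n. a z ^ k) - 1 / (1 - a z) = - (a z ^ n / (1 - a z))"
        by (simp add: diff_divide_distrib)
      then have "dist (\<Sum>k<n. a z ^ k) (1 / (1 - a z)) = norm (a z) ^ n / norm (1 - a z)"
        by (simp add: dist_norm norm_divide norm_power)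
      also have "\<dots> \<le> q ^ n / (1 - q)"
        using nq \<open>1 - q \<le> norm (1 - a z)\<close> assms(3) q0 by (intro frac_le power_mono) auto
      also have "\<dots> < e" using n assms(3) by (simp add: divide_simps)
      finally show ?thesis .
    qed
    then show "\<exists>g. entire_approximable L g \<and> (\<forall>z\<in>L. dist (g z) (1 / (1 - a z)) < e)"
      using assms(1,2)
      by (intro exI[of _ "\<lambda>z. \<Sum>k<n. a z ^ k"])
         (auto intro: entire_approximable_sum entire_approximable_power)
  qed
qed

text \<open>Factoring \<open>w' - z = (w - z) * (1 - (w - w') / (w - z))\<close> writes the new
  function as the old one times a geometric series with ratio of modulus at most
  \<open>q\<close>.\<close>

lemma entire_approximable_shift_pole:
  assumes "compact L" "entire_approximable L (\<lambda>z. 1 / (w - z))"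
    and "q < 1" "\<And>z. z \<in> L \<Longrightarrow> dist w' w \<le> q * dist w z" "w \<notin> L"
  shows "entire_approximable L (\<lambda>z. 1 / (w' - z))"
proof -
  have "entire_approximable L (\<lambda>z. 1 / (1 - (w - w') * (1 / (w - z))))"
  proof (rule entire_approximable_geometric[OF assms(1) _ assms(3)])
    show "entire_approximable L (\<lambda>z. (w - w') * (1 / (w - z)))"
      by (rule entire_approximable_cmult[OF assms(1,2)])
    show "norm ((w - w') * (1 / (w - z))) \<le> q" if "z \<in> L" for z
      using assms(4)[OF that] assms(5) that
      by (auto simp: norm_divide dist_norm norm_minus_commute divide_simps)
  qed
  then have "entire_approximable L (\<lambda>z. 1 / (w - z) * (1 / (1 - (w - w') * (1 / (w - z)))))"
    by (intro entire_approximable_mult assms(1,2))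
  then show ?thesis
  proof (rule entire_approximable_cong)
    fix z assume "z \<in> L"
    then have "w \<noteq> z" using assms(5) by auto
    then have "(w - z) * (1 - (w - w') * (1 / (w - z))) = w' - z"
      by (simp add: field_simps)
    then show "1 / (w - z) * (1 / (1 - (w - w') * (1 / (w - z)))) = 1 / (w' - z)"
      by (metis divide_divide_eq_left mult.right_neutral times_divide_eq_right)
  qed
qed

text \<open>Pole pushing: the poles \<open>w\<close> for which the claim holds form a clopen subset of the
  complement of \<open>L\<close>, and contain all \<open>w\<close> of large modulus.\<close>

lemma entire_approximable_pole:
  assumes "compact L" "connected (- L)" "w \<notin> L"
  shows "entire_approximable L (\<lambda>z. 1 / (w - z))"
\<comment> \<open>\<open>infdist w {}\<close> is 0 by convention, so the distance argument below
  requires a point of \<open>L\<close>.\<close>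
proof (cases "L = {}")
  case True
  then show ?thesis by (auto simp: entire_approximable_def intro: holomorphic_on_const)
next
  case ne: False
  define W where "W = {w \<in> - L. entire_approximable L (\<lambda>z. 1 / (w - z))}"
  have closed: "closed L" using assms(1) by (rule compact_imp_closed)
  have pos: "infdist w L > 0" if "w \<notin> L" for w
    using in_closed_iff_infdist_zero[OF closed ne, of w] infdist_nonneg[of w L] that by linarith
  \<comment> \<open>Moving by at most half the distance to \<open>L\<close> keeps \<open>w'\<close>
    off \<open>L\<close> and gives the ratio 1/2 in the geometric series.\<close>
  have near: "w' \<in> W" if w: "w \<in> W" and d: "dist w' w \<le> infdist w L / 2" for w w'
  proof -
    have wL: "w \<notin> L" using w by (simp add: W_def)
    have "w' \<notin> L"
      using infdist_le[of w' L w] d pos[OF wL] by (auto simp: dist_commute)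
    have "dist w' w \<le> 1 / 2 * dist w z" if "z \<in> L" for z
      using infdist_le[OF that, of w] d by simp
    then have "entire_approximable L (\<lambda>z. 1 / (w' - z))"
      using entire_approximable_shift_pole[OF assms(1), of w "1/2"] w wL by (simp add: W_def)
    with \<open>w' \<notin> L\<close> show ?thesis by (simp add: W_def)
  qed
  have "open W"
    unfolding open_dist
  proof
    fix w assume w: "w \<in> W"
    then have "infdist w L / 2 > 0" using pos by (simp add: W_def)
    with near[OF w] show "\<exists>e>0. \<forall>y. dist y w < e \<longrightarrow> y \<in> W"
      by (meson less_imp_le)
  qed
  moreover have "open (- L - W)"
    unfolding open_dist
  proof
    fix w' assume w': "w' \<in> - L - W"
    \<comment> \<open>\<open>infdist\<close> is 1-Lipschitz, so moving by less than a third of the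
      distance leaves \<open>y\<close> more than two thirds away from \<open>L\<close>. Then
      \<open>w'\<close> is within half the distance from \<open>y\<close> to \<open>L\<close>, and
      \<open>y \<in> W\<close> would put \<open>w'\<close> into \<open>W\<close>.\<close>
    have "y \<in> - L - W" if y: "dist y w' < infdist w' L / 3" for y
    proof -
      have *: "infdist w' L \<le> infdist y L + dist w' y" by (rule infdist_triangle)
      have "infdist w' L > 0" using pos w' by blast
      with * y have "infdist y L > 0" by (simp add: dist_commute)
      then have "y \<notin> L" by auto
      moreover have "dist w' y \<le> infdist y L / 2"
        using * y by (simp add: dist_commute)
      then have "y \<notin> W" using near w' by blast
      ultimately show ?thesis by simp
    qed
    moreover have "infdist w' L / 3 > 0" using pos w' by simp
    ultimately show "\<exists>e>0. \<forall>y. dist y w' < e \<longrightarrow> y \<in> - L - W" by blast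
  qed
  ultimately have "W \<inter> - L = {} \<or> (- L - W) \<inter> - L = {}"
    by (intro connectedD[OF assms(2)]) auto
  moreover have "W \<inter> - L \<noteq> {}"
  proof -
    obtain B where B: "B > 0" "\<And>z. z \<in> L \<Longrightarrow> norm z \<le> B"
      by (metis assms(1) bounded_pos compact_imp_bounded)
    \<comment> \<open>With modulus \<open>2 * B\<close> the quotient \<open>z / w\<close> has
      modulus at most 1/2 on \<open>L\<close>, so \<open>1 / (w - z)\<close> expands in powers of
      \<open>z\<close>.\<close>
    define w where "w = complex_of_real (2 * B)"
    have nw: "norm w = 2 * B" using B(1) by (simp add: w_def)
    have "w \<notin> L" using B nw by force
    have "entire_approximable L (\<lambda>z. 1 / (1 - z / w))"
    proof (rule entire_approximable_geometric[OF assms(1)])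
      show "entire_approximable L (\<lambda>z. z / w)"
        using nw B(1) by (intro entire_approximable_holomorphic holomorphic_intros) auto
      show "norm (z / w) \<le> 1 / 2" if "z \<in> L" for z
        using B(1) B(2)[OF that] by (simp add: norm_divide nw)
    qed simp
    then have "entire_approximable L (\<lambda>z. 1 / w * (1 / (1 - z / w)))"
      by (rule entire_approximable_cmult[OF assms(1)])
    then have "entire_approximable L (\<lambda>z. 1 / (w - z))"
      using nw B(1) by (elim entire_approximable_cong) (auto simp: field_simps)
    with \<open>w \<notin> L\<close> show ?thesis by (auto simp: W_def)
  qed
  ultimately show ?thesis using assms(3) by (auto simp: W_def)
qed

section \<open>Complements of disjoint unions\<close>

text \<open>Induction on the index set: Janiszewski's theorem asks for a connected intersection of
  the two parts, and here it is empty, which counts as connected.\<close>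

lemma connected_Compl_disjoint_UN:
  fixes A :: "'i \<Rightarrow> complex set"
  assumes "finite I" "\<And>i. i \<in> I \<Longrightarrow> compact (A i)" "\<And>i. i \<in> I \<Longrightarrow> connected (- A i)"
    and "disjoint_family_on A I"
  shows "connected (- (\<Union>i\<in>I. A i))"
  using assms
proof (induction I)
  case (insert i I)
  have dis: "A i \<inter> (\<Union>j\<in>I. A j) = {}"
    using insert.prems(3) insert.hyps(2) by (force simp: disjoint_family_on_def)
  have "compact (\<Union>j\<in>I. A j)"
    using insert by (intro compact_UN) auto
  moreover have "connected (- (\<Union>j\<in>I. A j))"
    using insert by (auto simp: disjoint_family_on_def)
  ultimately have "connected (- (A i \<union> (\<Union>j\<in>I. A j)))"
    using insert.prems by (intro Janiszewski_connected compact_imp_closed) (simp_all add: dis)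
  then show ?case by simp
qed (simp add: connected_UNIV)

section \<open>Riemann sums and Cauchy integrals\<close>

text \<open>Riemann sums are finite combinations of the functions \<open>F t\<close>, hence in the
  class; uniform continuity on the compact set \<open>{0..1} \<times> L\<close> makes them converge
  uniformly in \<open>z\<close>.\<close>

lemma entire_approximable_integral:
  assumes "compact L" and cont: "continuous_on ({0..1} \<times> L) (\<lambda>(t, z). F t z)"
    and F: "\<And>t. t \<in> {0..1} \<Longrightarrow> entire_approximable L (F t)"
  shows "entire_approximable L (\<lambda>z. integral {0..1::real} (\<lambda>t. F t z))"
proof (rule entire_approximable_limit)
  fix e :: real assume e: "e > 0"
  have "uniformly_continuous_on ({0..1} \<times> L) (\<lambda>(t, z). F t z)"
    using assms(1) cont by (intro compact_uniformly_continuous compact_Times) auto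
  then obtain d where d: "d > 0" "\<And>x y. x \<in> {0..1} \<times> L \<Longrightarrow> y \<in> {0..1} \<times> L \<Longrightarrow> dist y x < d \<Longrightarrow>
      dist (case y of (t, z) \<Rightarrow> F t z) (case x of (t, z) \<Rightarrow> F t z) < e / 2"
    using e unfolding uniformly_continuous_on_def by (metis half_gt_zero)
  have d': "norm (F t z - F s z) \<le> e / 2" if "t \<in> {0..1}" "s \<in> {0..1}" "dist t s < d" "z \<in> L" for s t z
    using d(2)[of "(s, z)" "(t, z)"] that by (simp add: dist_Pair_Pair dist_norm)
  \<comment> \<open>The division is chosen from \<open>d\<close> alone, so the same tags serve every
    \<open>z\<close> in \<open>L\<close>.\<close>
  obtain p where p: "p tagged_division_of {0..1::real}" "(\<lambda>x. ball x d) fine p"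
    using fine_division_exists_real[OF gauge_ball[OF d(1)]] by blast
  define g where "g = (\<lambda>z. \<Sum>(x, k)\<in>p. complex_of_real (measure lborel k) * F x z)"
  have "entire_approximable L g"
    unfolding g_def split_def
    using tag_in_interval[OF p(1)]
    by (intro entire_approximable_sum entire_approximable_cmult F assms(1)) auto
  moreover have "dist (g z) (integral {0..1} (\<lambda>t. F t z)) < e" if z: "z \<in> L" for z
  proof -
    have contz: "continuous_on {0..1} (\<lambda>t. F t z)"
    proof -
      have "continuous_on {0..1} (\<lambda>t. (t, z))" by (intro continuous_intros)
      then show ?thesis
        using continuous_on_compose2[OF cont, of "{0..1}" "\<lambda>t. (t, z)"] z by auto
    qed
    have int: "(\<lambda>t. F t z) integrable_on {0..1}"
      by (rule integrable_continuous_real[OF contz])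
    have "g z - integral {0..1} (\<lambda>t. F t z) =
        (\<Sum>(x, k)\<in>p. complex_of_real (measure lborel k) * F x z - integral k (\<lambda>t. F t z))"
      using integral_combine_tagged_division_topdown[of "\<lambda>t. F t z" 0 1 p] int p(1)
      by (simp add: g_def sum_subtractf split_def)
    also have "norm \<dots> \<le> (\<Sum>(x, k)\<in>p. measure lborel k * (e / 2))"
      unfolding split_def
    proof (rule sum_norm_le)
      fix y assume "y \<in> p"
      then obtain x k where y: "y = (x, k)" "(x, k) \<in> p" by (cases y) auto
      obtain a b where k: "k = cbox a b" using tagged_division_ofD(4)[OF p(1) y(2)] by blast
      have xk: "x \<in> k" "k \<subseteq> {0..1}" using tagged_division_ofD(2,3)[OF p(1) y(2)] by auto
      have kb: "k \<subseteq> ball x d" using p(2) y(2) by (auto simp: fine_def)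
      have intk: "(\<lambda>t. F t z) integrable_on k"
        using k xk(2) contz by (metis continuous_on_subset integrable_continuous)
      \<comment> \<open>On the piece \<open>k\<close> with tag \<open>x\<close> the error is the
        integral of \<open>F x z - F t z\<close>, whose norm is at most \<open>e / 2\<close> because
        \<open>k\<close> lies in \<open>ball x d\<close>.\<close>
      have "((\<lambda>t. F x z - F t z) has_integral measure lborel k *\<^sub>R F x z - integral k (\<lambda>t. F t z)) k"
        using intk unfolding k by (intro has_integral_diff has_integral_const integrable_integral)
      then have "norm (measure lborel k *\<^sub>R F x z - integral k (\<lambda>t. F t z)) \<le> e / 2 * measure lborel k"
        unfolding k
      proof (rule has_integral_bound[rotated])
        fix t assume "t \<in> cbox a b"
        then show "norm (F x z - F t z) \<le> e / 2"
          using xk kb k z by (intro d') auto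
      qed (use e in simp)
      then show "norm (complex_of_real (measure lborel (snd y)) * F (fst y) z - integral (snd y) (\<lambda>t. F t z))
          \<le> measure lborel (snd y) * (e / 2)"
        by (simp add: y scaleR_conv_of_real mult.commute)
    qed
    also have "\<dots> = (\<Sum>(x, k)\<in>p. measure lborel k) * (e / 2)"
      by (simp add: sum_distrib_right split_def)
    also have "\<dots> = e / 2"
      using additive_content_tagged_division[of p 0 "1::real"] p(1) by simp
    finally show ?thesis using e by (simp add: dist_norm)
  qed
  ultimately show "\<exists>g. entire_approximable L g \<and>
      (\<forall>z\<in>L. dist (g z) (integral {0..1} (\<lambda>t. F t z)) < e)" by blast
qed

text \<open>At each parameter the integrand is a constant multiple of \<open>1 / (w - z)\<close>
  with \<open>w\<close> on the image curve, hence off \<open>L\<close>. Pole pushing handles it, and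
  integration over the parameter stays in the class.\<close>

lemma entire_approximable_circlepath_integral:
  assumes "compact L" "connected (- L)" "s \<ge> 0"
    and "continuous_on (sphere 0 s) h" "continuous_on (sphere 0 s) \<psi>" "\<psi> ` sphere 0 s \<inter> L = {}"
  shows "entire_approximable L (\<lambda>z. contour_integral (circlepath 0 s) (\<lambda>u. h u / (\<psi> u - z)))"
proof -
  let ?c = "circlepath 0 s" and ?c' = "\<lambda>t. vector_derivative (circlepath 0 s) (at t)"
  have c: "?c t \<in> sphere 0 s" if "t \<in> {0..1}" for t
    using that path_image_circlepath_nonneg[OF assms(3), of 0] by (auto simp: path_image_def)
  have ne: "\<psi> (?c t) \<noteq> z" if "t \<in> {0..1}" "z \<in> L" for t z
    using c[OF that(1)] assms(6) that(2) by blast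
  have contc: "continuous_on {0..1} ?c"
    using valid_path_circlepath valid_path_imp_path path_def by blast
  have contc': "continuous_on ({0..1} \<times> L) (\<lambda>x. ?c (fst x))"
    by (rule continuous_on_compose2[OF contc continuous_on_fst[OF continuous_on_id]]) auto
  have cc: "continuous_on ({0..1} \<times> L) (\<lambda>x. f (?c (fst x)))" if "continuous_on (sphere 0 s) f"
    for f :: "complex \<Rightarrow> complex"
    by (rule continuous_on_compose2[OF that contc']) (use c in force)
  show ?thesis
    unfolding contour_integral_integral
  proof (rule entire_approximable_integral[OF assms(1)])
    show "continuous_on ({0..1} \<times> L) (\<lambda>(t, z). h (?c t) / (\<psi> (?c t) - z) * ?c' t)"
      unfolding split_def vector_derivative_circlepath
      using ne by (intro continuous_intros cc assms(4,5)) auto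
    fix t :: real assume t: "t \<in> {0..1}"
    have "entire_approximable L (\<lambda>z. h (?c t) * ?c' t * (1 / (\<psi> (?c t) - z)))"
      using ne[OF t] by (intro entire_approximable_cmult entire_approximable_pole assms(1,2)) blast
    then show "entire_approximable L (\<lambda>z. h (?c t) / (\<psi> (?c t) - z) * ?c' t)"
      by (rule entire_approximable_cong) simp
  qed
qed

text \<open>Cauchy's formula transported by \<open>\<psi>\<close>: the factor \<open>(u - w) / (\<psi> u - \<psi> w)\<close> has a removable
  singularity with value \<open>1 / deriv \<psi> w\<close> at \<open>u = w\<close>.\<close>

lemma Cauchy_integral_injective:
  assumes "\<psi> holomorphic_on S" "f holomorphic_on S" "open S" "inj_on \<psi> S"
    and "cball 0 s \<subseteq> S" "w \<in> ball 0 s"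
  shows "contour_integral (circlepath 0 s) (\<lambda>u. f u * deriv \<psi> u / (\<psi> u - \<psi> w)) =
    2 * of_real pi * \<i> * f w"
proof -
  define D where "D = (\<lambda>u. if u = w then deriv \<psi> w else (\<psi> u - \<psi> w) / (u - w))"
  have wS: "w \<in> S" using assms(5,6) by auto
  have D: "D holomorphic_on S"
    unfolding D_def by (rule pole_lemma_open[OF assms(1,3)])
  have d0: "deriv \<psi> w \<noteq> 0"
    by (rule holomorphic_injective_imp_regular[OF assms(1,3,4) wS])
  \<comment> \<open>Away from \<open>w\<close> injectivity excludes zeros of the difference
    quotient; at \<open>w\<close> its value is the derivative, non-zero since an injective
    holomorphic map is regular.\<close>
  have D0: "D u \<noteq> 0" if "u \<in> S" for u
    using d0 inj_onD[OF assms(4) _ that wS] by (auto simp: D_def)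
  \<comment> \<open>Since \<open>\<psi> u - \<psi> w = D u * (u - w)\<close>, the usual Cauchy
    formula applies to this quotient, whose value at \<open>w\<close> is \<open>f w\<close>.\<close>
  have "(\<lambda>u. f u * deriv \<psi> u / D u) holomorphic_on S"
    using D0 by (intro holomorphic_on_divide holomorphic_on_mult holomorphic_deriv assms(1-3) D)
  then have "((\<lambda>u. f u * deriv \<psi> u / D u / (u - w)) has_contour_integral
      2 * of_real pi * \<i> * (f w * deriv \<psi> w / D w)) (circlepath 0 s)"
    using assms(5,6) by (intro Cauchy_integral_circlepath_simple) (auto intro: holomorphic_on_subset)
  then have "((\<lambda>u. f u * deriv \<psi> u / (\<psi> u - \<psi> w)) has_contour_integral
      2 * of_real pi * \<i> * (f w * deriv \<psi> w / D w)) (circlepath 0 s)"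
  proof (rule has_contour_integral_eq)
    fix u assume "u \<in> path_image (circlepath 0 s)"
    then have "u \<noteq> w" using assms(6) by (auto simp: path_image_circlepath_minus split: if_splits)
    then show "f u * deriv \<psi> u / D u / (u - w) = f u * deriv \<psi> u / (\<psi> u - \<psi> w)"
      by (simp add: D_def)
  qed
  then show ?thesis
    using d0 by (simp add: D_def contour_integral_unique)
qed

text \<open>As \<open>\<psi>\<close> omits \<open>z\<close> on the closed disc, the integrand is
  holomorphic there and Cauchy's theorem applies. This removes the contribution of one piece at the
  points of another.\<close>

lemma contour_integral_circlepath_pole_free:
  assumes "\<psi> holomorphic_on S" "h holomorphic_on S" "open S" "cball 0 s \<subseteq> S" "s > 0"
    and "z \<notin> \<psi> ` cball 0 s"
  shows "contour_integral (circlepath 0 s) (\<lambda>u. h u / (\<psi> u - z)) = 0"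
proof -
  have "(\<lambda>u. h u / (\<psi> u - z)) holomorphic_on cball 0 s"
    using assms by (intro holomorphic_intros) (auto intro: holomorphic_on_subset)
  then have "((\<lambda>u. h u / (\<psi> u - z)) has_contour_integral 0) (circlepath 0 s)"
    using assms(5)
    by (intro Cauchy_theorem_convex_simple[of _ "cball 0 s"]) 
       (auto simp: valid_path_circlepath path_image_circlepath_minus)
  then show ?thesis by (rule contour_integral_unique)
qed

section \<open>Simultaneous approximation on disjoint images of discs\<close>

text \<open>The target is prescribed at the points \<open>\<psi> i u\<close>, so that no inverse of
  \<open>\<psi> i\<close> appears. The gap between \<open>r\<close> and \<open>s\<close> keeps the
  integration curves off \<open>L\<close>.\<close>

lemma simultaneous_entire_approximation:
  fixes \<psi> :: "'i \<Rightarrow> complex \<Rightarrow> complex"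
  assumes "finite I" "0 < r" "r < s" "cball 0 s \<subseteq> S" "open S"
    and hol: "\<And>i. i \<in> I \<Longrightarrow> \<psi> i holomorphic_on S" and inj: "\<And>i. i \<in> I \<Longrightarrow> inj_on (\<psi> i) S"
    and holf: "\<And>i. i \<in> I \<Longrightarrow> f i holomorphic_on S"
    and dis: "disjoint_family_on (\<lambda>i. \<psi> i ` cball 0 s) I" and "e > 0"
  obtains p where "p holomorphic_on UNIV"
    "\<And>i u. i \<in> I \<Longrightarrow> u \<in> cball 0 r \<Longrightarrow> dist (p (\<psi> i u)) (f i u) < e"
proof -
  define L where "L = (\<Union>i\<in>I. \<psi> i ` cball 0 r)"
  have rs: "cball 0 r \<subseteq> ball (0::complex) s" "cball 0 r \<subseteq> cball (0::complex) s"
    using assms(3) by auto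
  have rS: "cball 0 r \<subseteq> S" using rs assms(4) by blast
  have cont: "continuous_on S (\<psi> i)" if "i \<in> I" for i
    using hol[OF that] by (rule holomorphic_on_imp_continuous_on)
  have compA: "compact (\<psi> i ` cball 0 r)" if "i \<in> I" for i
    using cont[OF that] rS by (intro compact_continuous_image) (auto intro: continuous_on_subset)
  then have compL: "compact L"
    unfolding L_def using assms(1) by (intro compact_UN) auto
  have connL: "connected (- L)"
    unfolding L_def
  proof (rule connected_Compl_disjoint_UN[OF assms(1) compA])
    show "disjoint_family_on (\<lambda>i. \<psi> i ` cball 0 r) I"
      using dis rs(2) unfolding disjoint_family_on_def by blast
    fix i assume i: "i \<in> I"
    \<comment> \<open>A continuous injection of a compact disc is a homeomorphism onto its image,
      and a homeomorphic copy of a compact convex set does not separate the plane.\<close>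
    have "cball (0::complex) r homeomorphic \<psi> i ` cball 0 r"
      using homeomorphic_compact[OF compact_cball continuous_on_subset[OF cont[OF i] rS] refl
          inj_on_subset[OF inj[OF i] rS]] .
    then show "connected (- \<psi> i ` cball 0 r)"
      by (intro connected_complement_homeomorphic_convex_compact[OF homeomorphic_sym[THEN iffD1]
            convex_cball compact_cball]) (auto simp: DIM_complex)
  qed
  \<comment> \<open>The Cauchy integral over the image curve, pulled back to the circle by the
    substitution \<open>\<psi> i u\<close>; this produces the factor
    \<open>deriv (\<psi> i) u\<close>.\<close>
  define J where "J = (\<lambda>i z. contour_integral (circlepath 0 s)
    (\<lambda>u. f i u * deriv (\<psi> i) u / (\<psi> i u - z)))"
  have sS: "sphere 0 s \<subseteq> S" using assms(4) sphere_cball by blast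
  have "entire_approximable L (J i)" if i: "i \<in> I" for i
    unfolding J_def
  proof (rule entire_approximable_circlepath_integral[OF compL connL])
    have "(\<lambda>u. f i u * deriv (\<psi> i) u) holomorphic_on S"
      using holf hol i assms(5) by (intro holomorphic_on_mult holomorphic_deriv)
    then show "continuous_on (sphere 0 s) (\<lambda>u. f i u * deriv (\<psi> i) u)"
      using sS holomorphic_on_imp_continuous_on continuous_on_subset by blast
    show "continuous_on (sphere 0 s) (\<psi> i)"
      using sS cont[OF i] continuous_on_subset by blast
    \<comment> \<open>The curve avoids its own piece by injectivity, as \<open>u\<close> and
      \<open>w\<close> have different moduli, and the other pieces by disjointness of the images of
      the larger discs.\<close>
    have "\<psi> i u \<noteq> \<psi> j w" if u: "u \<in> sphere 0 s" and j: "j \<in> I" and w: "w \<in> cball 0 r" for u j w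
    proof (cases "j = i")
      case True
      have "u \<noteq> w" using u w assms(3) by auto
      then show ?thesis
        using True inj_onD[OF inj[OF i]] u w sS rS by blast
    next
      case False
      then have "\<psi> i ` cball 0 s \<inter> \<psi> j ` cball 0 s = {}"
        using dis i j by (simp add: disjoint_family_on_def)
      then show ?thesis using u w rs(2) sphere_cball by blast
    qed
    then show "\<psi> i ` sphere 0 s \<inter> L = {}" unfolding L_def by blast
  qed (use assms(2,3) in simp)
  then have "entire_approximable L (\<lambda>z. \<Sum>i\<in>I. 1 / (2 * of_real pi * \<i>) * J i z)"
    by (intro entire_approximable_sum entire_approximable_cmult compL)
  then obtain p where p: "p holomorphic_on UNIV"
    "\<And>z. z \<in> L \<Longrightarrow> dist (p z) (\<Sum>i\<in>I. 1 / (2 * of_real pi * \<i>) * J i z) < e"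
    using \<open>e > 0\<close> unfolding entire_approximable_def by blast
  show ?thesis
  proof (rule that[OF p(1)])
    fix j and w :: complex assume j: "j \<in> I" and w: "w \<in> cball 0 r"
    \<comment> \<open>At a point of the \<open>j\<close>-th piece only the \<open>j\<close>-th
      Cauchy integral survives, so the sum reproduces \<open>f j\<close>.\<close>
    have "1 / (2 * of_real pi * \<i>) * J i (\<psi> j w) = (if i = j then f j w else 0)" if i: "i \<in> I" for i
    proof (cases "i = j")
      case True
      have "J j (\<psi> j w) = 2 * of_real pi * \<i> * f j w"
        unfolding J_def using j w rs(1)
        by (intro Cauchy_integral_injective[OF hol holf assms(5) inj assms(4)]) auto
      then show ?thesis using True by simp
    next
      case False
      have "J i (\<psi> j w) = 0"
        unfolding J_def
      proof (rule contour_integral_circlepath_pole_free[OF hol[OF i] _ assms(5,4)])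
        show "(\<lambda>u. f i u * deriv (\<psi> i) u) holomorphic_on S"
          using holf hol i assms(5) by (intro holomorphic_on_mult holomorphic_deriv)
        have "\<psi> i ` cball 0 s \<inter> \<psi> j ` cball 0 s = {}"
          using dis i j False by (simp add: disjoint_family_on_def)
        then show "\<psi> j w \<notin> \<psi> i ` cball 0 s" using w rs(2) by blast
      qed (use assms(2,3) in simp)
      then show ?thesis using False by simp
    qed
    then have "(\<Sum>i\<in>I. 1 / (2 * of_real pi * \<i>) * J i (\<psi> j w)) = (\<Sum>i\<in>I. if i = j then f j w else 0)"
      by (rule sum.cong[OF refl])
    also have "\<dots> = f j w" using assms(1) j by simp
    finally have "(\<Sum>i\<in>I. 1 / (2 * of_real pi * \<i>) * J i (\<psi> j w)) = f j w" .
    moreover have "\<psi> j w \<in> L" unfolding L_def using j w by blast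
    ultimately show "dist (p (\<psi> j w)) (f j w) < e" using p(2) by metis
  qed
qed

section \<open>Iterates, basic neighbourhoods and Furstenberg families\<close>

lemma funpow_self_map:
  assumes "\<phi> holomorphic_on S" "\<phi> ` S \<subseteq> S"
  shows "(\<phi> ^^ n) holomorphic_on S" "(\<phi> ^^ n) ` S \<subseteq> S" "inj_on \<phi> S \<Longrightarrow> inj_on (\<phi> ^^ n) S"
proof -
  have *: "(\<phi> ^^ n) holomorphic_on S \<and> (\<phi> ^^ n) ` S \<subseteq> S \<and> (inj_on \<phi> S \<longrightarrow> inj_on (\<phi> ^^ n) S)"
  proof (induction n)
    case 0
    then show ?case by (simp add: id_def)
  next
    case (Suc n)
    have "\<phi> \<circ> (\<phi> ^^ n) holomorphic_on S"
      using Suc assms by (intro holomorphic_on_compose_gen[of _ _ _ S]) auto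
    moreover have "inj_on (\<phi> \<circ> (\<phi> ^^ n)) S" if "inj_on \<phi> S"
      using Suc that by (intro comp_inj_on) (auto intro: inj_on_subset)
    moreover have "(\<phi> \<circ> (\<phi> ^^ n)) ` S \<subseteq> S"
      using Suc assms(2) by force
    ultimately show ?case by (simp only: funpow.simps) blast
  qed
  then show "(\<phi> ^^ n) holomorphic_on S" "(\<phi> ^^ n) ` S \<subseteq> S" "inj_on \<phi> S \<Longrightarrow> inj_on (\<phi> ^^ n) S"
    by auto
qed

lemma comp_op_funpow:
  assumes "\<phi> ` unit_disc \<subseteq> unit_disc" "f \<in> hol_disc"
  shows "(comp_op \<phi> ^^ n) f = comp_op (\<phi> ^^ n) f"
proof (induction n)
  case 0
  \<comment> \<open>For \<open>n = 0\<close> the right-hand side cuts \<open>f\<close> off outside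
    the disc, which changes nothing because members of \<open>hol_disc\<close> vanish there.\<close>
  then show ?case using assms(2) by (auto simp: comp_op_def hol_disc_def)
next
  case (Suc n)
  have "(comp_op \<phi> ^^ Suc n) f = comp_op \<phi> (comp_op (\<phi> ^^ n) f)"
    by (simp add: Suc)
  also have "\<dots> = comp_op (\<phi> ^^ Suc n) f"
  proof
    fix z
    show "comp_op \<phi> (comp_op (\<phi> ^^ n) f) z = comp_op (\<phi> ^^ Suc n) f z"
      using image_subset_iff[THEN iffD1, OF assms(1)]
      by (simp add: comp_op_def funpow_swap1 del: mem_ball)
  qed
  finally show ?case .
qed

text \<open>On a non-empty compact \<open>K\<close> the distance from \<open>g\<close> to
  \<open>h\<close> attains its maximum, which is below \<open>e\<close>; the remaining gap is the
  radius of a neighbourhood of \<open>g\<close>.\<close>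

lemma openin_hol_disc_nhd:
  assumes "compact K" "K \<subseteq> unit_disc" "h \<in> hol_disc"
  shows "openin hol_disc_topology {g \<in> hol_disc. \<forall>z\<in>K. dist (g z) (h z) < e}"
  unfolding openin_hol_disc
proof (intro conjI ballI)
  fix g assume "g \<in> {g \<in> hol_disc. \<forall>z\<in>K. dist (g z) (h z) < e}"
  then have g: "g \<in> hol_disc" "\<And>z. z \<in> K \<Longrightarrow> dist (g z) (h z) < e" by auto
  have "\<exists>d>0. \<forall>z\<in>K. dist (g z) (h z) + d \<le> e"
  proof (cases "K = {}")
    case False
    have "continuous_on K g" "continuous_on K h"
      using g(1) assms(2,3) unfolding hol_disc_def
      by (auto intro: continuous_on_subset holomorphic_on_imp_continuous_on)
    then have "continuous_on K (\<lambda>z. dist (g z) (h z))" by (rule continuous_on_dist)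
    then obtain w where w: "w \<in> K" "\<And>z. z \<in> K \<Longrightarrow> dist (g z) (h z) \<le> dist (g w) (h w)"
      using continuous_attains_sup[OF assms(1) False] by blast
    then show ?thesis
      using g(2)[OF w(1)] by (intro exI[of _ "e - dist (g w) (h w)"]) auto
  qed (auto intro: exI[of _ 1])
  then obtain d where d: "d > 0" "\<And>z. z \<in> K \<Longrightarrow> dist (g z) (h z) + d \<le> e" by blast
  have "{f \<in> hol_disc. \<forall>z\<in>K. dist (f z) (g z) < d} \<subseteq> {g \<in> hol_disc. \<forall>z\<in>K. dist (g z) (h z) < e}"
  proof clarify
    fix f z assume "\<forall>z\<in>K. dist (f z) (g z) < d" "z \<in> K"
    then show "dist (f z) (h z) < e"
      using d(2)[of z] dist_triangle[of "f z" "h z" "g z"] by force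
  qed
  then show "\<exists>K' d. compact K' \<and> K' \<subseteq> unit_disc \<and> d > 0 \<and>
      {f \<in> hol_disc. \<forall>z\<in>K'. dist (f z) (g z) < d} \<subseteq> {g \<in> hol_disc. \<forall>z\<in>K. dist (g z) (h z) < e}"
    using assms(1,2) d(1) by blast
qed auto

lemma furstenberg_family_mono:
  "furstenberg_family \<F> \<Longrightarrow> {n \<in> {1..}. P n} \<in> \<F> \<Longrightarrow> (\<And>n. n \<ge> 1 \<Longrightarrow> P n \<Longrightarrow> Q n) \<Longrightarrow>
     {n \<in> {1..}. Q n} \<in> \<F>"
proof -
  assume "furstenberg_family \<F>" "{n \<in> {1..}. P n} \<in> \<F>" and imp: "\<And>n. n \<ge> 1 \<Longrightarrow> P n \<Longrightarrow> Q n"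
  moreover have "{n \<in> {1..}. P n} \<subseteq> {n \<in> {1..}. Q n}" "{n \<in> {1..}. Q n} \<subseteq> {1..}"
    using imp by auto
  ultimately show ?thesis
    unfolding furstenberg_family_def by blast
qed

lemma furstenberg_family_ex:
  "furstenberg_family \<F> \<Longrightarrow> {n \<in> {1..}. P n} \<in> \<F> \<Longrightarrow> \<exists>n\<ge>1. P n"
proof (rule ccontr)
  assume "furstenberg_family \<F>" "{n \<in> {1..}. P n} \<in> \<F>" "\<not> (\<exists>n\<ge>1. P n)"
  moreover from this(3) have "{n \<in> {1..}. P n} = {}" by auto
  ultimately show False by (metis furstenberg_family_def)
qed

section \<open>Transitivity as an approximation problem\<close>

text \<open>Uniform neighbourhoods on compact sets form a base, and finitely many of them admit a
  common \<open>K\<close> and \<open>e\<close>. Taking \<open>id\<close> as the zeroth map puts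
  \<open>U 0\<close> on the same footing as the other sets.\<close>

lemma disjoint_transitive_comp_op_iff:
  assumes F: "furstenberg_family \<F>"
    and hol: "\<And>i. i \<in> {1..N} \<Longrightarrow> \<phi> i holomorphic_on unit_disc"
    and maps: "\<And>i. i \<in> {1..N} \<Longrightarrow> \<phi> i ` unit_disc \<subseteq> unit_disc"
  shows "disjoint_transitive \<F> hol_disc_topology N (\<lambda>i. comp_op (\<phi> i)) \<longleftrightarrow>
    (\<forall>K e h. compact K \<and> K \<subseteq> unit_disc \<and> e > 0 \<and> (\<forall>i\<in>{0..N}. h i \<in> hol_disc) \<longrightarrow>
      {n \<in> {1..}. \<exists>f\<in>hol_disc. \<forall>i\<in>{0..N}. \<forall>z\<in>K.
        dist (f ((if i = 0 then id else \<phi> i ^^ n) z)) (h i z) < e} \<in> \<F>)"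
    (is "?L \<longleftrightarrow> ?R")
proof
  assume trans: ?L
  show ?R
  proof (intro allI impI)
    fix K and e :: real and h
    assume *: "compact K \<and> K \<subseteq> unit_disc \<and> e > 0 \<and> (\<forall>i\<in>{0..N}. h i \<in> hol_disc)"
    define U where "U = (\<lambda>i. {g \<in> hol_disc. \<forall>z\<in>K. dist (g z) (h i z) < e})"
    have "openin hol_disc_topology (U i) \<and> U i \<noteq> {}" if "i \<in> {0..N}" for i
    proof
      show "openin hol_disc_topology (U i)"
        unfolding U_def using * that by (intro openin_hol_disc_nhd) auto
      have "h i \<in> U i" using * that by (auto simp: U_def)
      then show "U i \<noteq> {}" by blast
    qed
    then have "{n \<in> {1..}. U 0 \<inter> (\<Inter>i\<in>{1..N}.
        {x \<in> topspace hol_disc_topology. (comp_op (\<phi> i) ^^ n) x \<in> U i}) \<noteq> {}} \<in> \<F>"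
      using trans unfolding disjoint_transitive_def by blast
    then show "{n \<in> {1..}. \<exists>f\<in>hol_disc. \<forall>i\<in>{0..N}. \<forall>z\<in>K.
        dist (f ((if i = 0 then id else \<phi> i ^^ n) z)) (h i z) < e} \<in> \<F>"
    proof (rule furstenberg_family_mono[OF F])
      fix n :: nat
      assume "U 0 \<inter> (\<Inter>i\<in>{1..N}.
        {x \<in> topspace hol_disc_topology. (comp_op (\<phi> i) ^^ n) x \<in> U i}) \<noteq> {}"
      then obtain f where f: "f \<in> U 0" "\<And>i. i \<in> {1..N} \<Longrightarrow> (comp_op (\<phi> i) ^^ n) f \<in> U i" by blast
      have fh: "f \<in> hol_disc" using f(1) by (simp add: U_def)
      have "dist (f ((if i = 0 then id else \<phi> i ^^ n) z)) (h i z) < e" if i: "i \<in> {0..N}" and z: "z \<in> K" for i z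
      proof (cases "i = 0")
        case True
        then show ?thesis using f(1) z by (simp add: U_def)
      next
        case False
        then have i': "i \<in> {1..N}" using i by auto
        have "comp_op (\<phi> i ^^ n) f \<in> U i"
          using f(2)[OF i'] comp_op_funpow[OF maps[OF i'] fh] by simp
        then have "dist (comp_op (\<phi> i ^^ n) f z) (h i z) < e" using z by (simp add: U_def)
        then show ?thesis using False z * by (auto simp: comp_op_def split: if_splits)
      qed
      then show "\<exists>f\<in>hol_disc. \<forall>i\<in>{0..N}. \<forall>z\<in>K.
        dist (f ((if i = 0 then id else \<phi> i ^^ n) z)) (h i z) < e" using fh by blast
    qed
  qed
next
  assume R: ?R
  show ?L
    unfolding disjoint_transitive_def
  proof (intro allI impI)
    fix U :: "nat \<Rightarrow> (complex \<Rightarrow> complex) set"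
    assume U: "\<forall>i\<in>{0..N}. openin hol_disc_topology (U i) \<and> U i \<noteq> {}"
    define nhd where "nhd = (\<lambda>i h K e. h \<in> hol_disc \<and> compact K \<and> K \<subseteq> unit_disc \<and> e > 0 \<and>
        {g \<in> hol_disc. \<forall>z\<in>K. dist (g z) (h z) < e} \<subseteq> U i)"
    have "\<exists>h K e. nhd i h K e" if i: "i \<in> {0..N}" for i
    proof -
      have "U i \<noteq> {}" and op: "openin hol_disc_topology (U i)" using U i by auto
      then obtain h where h: "h \<in> U i" "h \<in> hol_disc"
        using openin_subset by fastforce
      then have "\<exists>K e. compact K \<and> K \<subseteq> unit_disc \<and> e > 0 \<and>
          {g \<in> hol_disc. \<forall>z\<in>K. dist (g z) (h z) < e} \<subseteq> U i"
        using op[unfolded openin_hol_disc] by (elim conjE bspec)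
      with h(2) show ?thesis unfolding nhd_def by (intro exI[of _ h]) simp
    qed
    then obtain h K e where "\<And>i. i \<in> {0..N} \<Longrightarrow> nhd i (h i) (K i) (e i)"
      by metis
    then have hKe: "h i \<in> hol_disc" "compact (K i)" "K i \<subseteq> unit_disc" "e i > 0"
      "{g \<in> hol_disc. \<forall>z\<in>K i. dist (g z) (h i z) < e i} \<subseteq> U i" if "i \<in> {0..N}" for i
      using that unfolding nhd_def by blast+
    \<comment> \<open>The union of the compact sets and the minimum of the tolerances refine all
      \<open>N + 1\<close> neighbourhoods at once.\<close>
    define K' where "K' = (\<Union>i\<in>{0..N}. K i)"
    define d where "d = Min (e ` {0..N})"
    have "d > 0" using hKe by (simp add: d_def)
    have d: "d \<le> e i" if "i \<in> {0..N}" for i using that by (auto simp: d_def)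
    have K': "K' \<subseteq> unit_disc" unfolding K'_def using hKe by blast
    have "compact K'" unfolding K'_def using hKe by (intro compact_UN) auto
    then have "{n \<in> {1..}. \<exists>f\<in>hol_disc. \<forall>i\<in>{0..N}. \<forall>z\<in>K'.
        dist (f ((if i = 0 then id else \<phi> i ^^ n) z)) (h i z) < d} \<in> \<F>"
      using R hKe K' \<open>d > 0\<close> by blast
    then show "{n \<in> {1..}. U 0 \<inter> (\<Inter>i\<in>{1..N}.
        {x \<in> topspace hol_disc_topology. (comp_op (\<phi> i) ^^ n) x \<in> U i}) \<noteq> {}} \<in> \<F>"
    proof (rule furstenberg_family_mono[OF F])
      fix n :: nat
      assume "\<exists>f\<in>hol_disc. \<forall>i\<in>{0..N}. \<forall>z\<in>K'.
        dist (f ((if i = 0 then id else \<phi> i ^^ n) z)) (h i z) < d"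
      then obtain f where f: "f \<in> hol_disc" "\<And>i z. i \<in> {0..N} \<Longrightarrow> z \<in> K' \<Longrightarrow>
        dist (f ((if i = 0 then id else \<phi> i ^^ n) z)) (h i z) < d" by blast
      show "U 0 \<inter> (\<Inter>i\<in>{1..N}.
        {x \<in> topspace hol_disc_topology. (comp_op (\<phi> i) ^^ n) x \<in> U i}) \<noteq> {}"
      proof -
        \<comment> \<open>Used with \<open>g\<close> equal to \<open>f\<close> for index 0 and to
          the iterated operator applied to \<open>f\<close> for the others.\<close>
        have mem: "g \<in> U i" if i: "i \<in> {0..N}" and g: "g \<in> hol_disc"
          and eq: "\<And>z. z \<in> K' \<Longrightarrow> g z = f ((if i = 0 then id else \<phi> i ^^ n) z)" for g i
        proof -
          have "dist (g z) (h i z) < e i" if z: "z \<in> K i" for z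
          proof -
            have "z \<in> K'" using z i by (auto simp: K'_def)
            then show ?thesis using f(2)[OF i] eq d[OF i] by fastforce
          qed
          then show ?thesis using hKe(5)[OF i] g by blast
        qed
        have "(comp_op (\<phi> i) ^^ n) f \<in> U i" if i: "i \<in> {1..N}" for i
          unfolding comp_op_funpow[OF maps[OF i] f(1)]
        proof (rule mem)
          show "comp_op (\<phi> i ^^ n) f \<in> hol_disc"
            using hol[OF i] maps[OF i] f(1) by (intro comp_op_in_hol_disc funpow_self_map)
          show "comp_op (\<phi> i ^^ n) f z = f ((if i = 0 then id else \<phi> i ^^ n) z)" if "z \<in> K'" for z
            using that i K' by (auto simp: comp_op_def)
        qed (use i in simp)
        moreover have "f \<in> U 0" using f(1) by (intro mem) auto
        ultimately show ?thesis using f(1) by auto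
      qed
    qed
  qed
qed

lemma compact_subset_ball_subset_cball:
  fixes K :: "'a::real_normed_vector set"
  assumes "compact K" "K \<subseteq> ball 0 1"
  obtains r where "0 < r" "r < 1" "K \<subseteq> cball 0 r"
proof (cases "K = {}")
  case True
  then show ?thesis using that[of "1/2"] by simp
next
  case False
  obtain w where w: "w \<in> K" "\<And>z. z \<in> K \<Longrightarrow> norm z \<le> norm w"
    using continuous_attains_sup[OF assms(1) False, of norm] continuous_on_norm_id by blast
  show ?thesis
    \<comment> \<open>\<open>norm w\<close> may be 0; the maximum with 1/2 keeps the radius
      positive.\<close>
    using w assms(2) by (intro that[of "max (1/2) (norm w)"]) (auto simp: subset_eq le_max_iff_disj)
qed

section \<open>Necessity of injectivity and disjointness\<close>

lemma comp_op_transitive_imp_inj_on: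
  assumes F: "furstenberg_family \<F>"
    and trans: "disjoint_transitive \<F> hol_disc_topology N (\<lambda>i. comp_op (\<phi> i))"
    and hol: "\<And>i. i \<in> {1..N} \<Longrightarrow> \<phi> i holomorphic_on unit_disc"
    and maps: "\<And>i. i \<in> {1..N} \<Longrightarrow> \<phi> i ` unit_disc \<subseteq> unit_disc"
    and i: "i \<in> {1..N}"
  shows "inj_on (\<phi> i) unit_disc"
proof (rule inj_onI, rule ccontr)
  fix a b assume ab: "a \<in> unit_disc" "b \<in> unit_disc" "\<phi> i a = \<phi> i b" "a \<noteq> b"
  define h where "h = (\<lambda>z. if z \<in> unit_disc then z else 0)"
  \<comment> \<open>With half the distance as tolerance, one value of \<open>f\<close> cannot be
    close to both \<open>a\<close> and \<open>b\<close>.\<close>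
  define K and e where "K = {a, b}" and "e = dist a b / 2"
  have "(\<lambda>z. z) holomorphic_on unit_disc" by (rule holomorphic_on_ident)
  then have "h holomorphic_on unit_disc"
    by (rule holomorphic_transform) (simp add: h_def)
  then have "h \<in> hol_disc" by (simp add: hol_disc_def h_def)
  moreover have "compact K" "K \<subseteq> unit_disc" "e > 0" using ab by (auto simp: K_def e_def)
  ultimately have "{n \<in> {1..}. \<exists>f\<in>hol_disc. \<forall>i\<in>{0..N}. \<forall>z\<in>K.
      dist (f ((if i = 0 then id else \<phi> i ^^ n) z)) (h z) < e} \<in> \<F>"
    using disjoint_transitive_comp_op_iff[OF F hol maps, THEN iffD1, OF _ _ trans,
      rule_format, of K e "\<lambda>_. h"] by simp
  from furstenberg_family_ex[OF F this] obtain n f where n: "n \<ge> 1" and f: "\<forall>i\<in>{0..N}. \<forall>z\<in>K.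
      dist (f ((if i = 0 then id else \<phi> i ^^ n) z)) (h z) < e" by blast
  \<comment> \<open>Here \<open>n \<ge> 1\<close> matters: the innermost application of
    \<open>\<phi> i\<close> already identifies \<open>a\<close> and \<open>b\<close>, hence so does
    the iterate.\<close>
  obtain m where "n = Suc m" using n by (cases n) auto
  then have "(\<phi> i ^^ n) a = (\<phi> i ^^ n) b" using ab(3) by (simp add: funpow_swap1)
  moreover have "dist (f ((\<phi> i ^^ n) z)) z < e" if "z \<in> K" for z
    using bspec[OF bspec[OF f, of i], of z] i that \<open>K \<subseteq> unit_disc\<close> by (auto simp: h_def)
  ultimately have "dist (f ((\<phi> i ^^ n) a)) a < e" "dist (f ((\<phi> i ^^ n) a)) b < e"
    by (metis K_def insertCI)+
  then show False using dist_triangle_half_r[of "f ((\<phi> i ^^ n) a)" a "2 * e" b] by (simp add: e_def)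
qed

text \<open>A common point \<open>w\<close> of the \<open>i\<close>-th and \<open>j\<close>-th
  images would place the single value \<open>f w\<close> within 1/2 of two distinct
  integers.\<close>

lemma comp_op_transitive_imp_disjoint_images:
  assumes F: "furstenberg_family \<F>"
    and trans: "disjoint_transitive \<F> hol_disc_topology N (\<lambda>i. comp_op (\<phi> i))"
    and hol: "\<And>i. i \<in> {1..N} \<Longrightarrow> \<phi> i holomorphic_on unit_disc"
    and maps: "\<And>i. i \<in> {1..N} \<Longrightarrow> \<phi> i ` unit_disc \<subseteq> unit_disc"
    and K: "compact K" "K \<subseteq> unit_disc"
  shows "{n \<in> {1..}. disjoint_family_on (\<lambda>i. (if i = 0 then id else \<phi> i ^^ n) ` K) {0..N}} \<in> \<F>"
proof -
  define h where "h = (\<lambda>(i::nat) z::complex. if z \<in> unit_disc then (of_nat i :: complex) else 0)"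
  have "h i \<in> hol_disc" for i
  proof -
    have "(\<lambda>z. of_nat i) holomorphic_on unit_disc" by (rule holomorphic_on_const)
    then have "h i holomorphic_on unit_disc"
      by (rule holomorphic_transform) (simp add: h_def)
    then show ?thesis by (simp add: hol_disc_def h_def)
  qed
  then have "{n \<in> {1..}. \<exists>f\<in>hol_disc. \<forall>i\<in>{0..N}. \<forall>z\<in>K.
      dist (f ((if i = 0 then id else \<phi> i ^^ n) z)) (h i z) < 1 / 2} \<in> \<F>"
    using disjoint_transitive_comp_op_iff[OF F hol maps, THEN iffD1, OF _ _ trans,
      rule_format, of K "1/2" h] K by simp
  then show ?thesis
  proof (rule furstenberg_family_mono[OF F])
    fix n :: nat
    assume "\<exists>f\<in>hol_disc. \<forall>i\<in>{0..N}. \<forall>z\<in>K.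
      dist (f ((if i = 0 then id else \<phi> i ^^ n) z)) (h i z) < 1 / 2"
    then obtain f where f: "\<And>i z. i \<in> {0..N} \<Longrightarrow> z \<in> K \<Longrightarrow>
      dist (f ((if i = 0 then id else \<phi> i ^^ n) z)) (h i z) < 1 / 2" by blast
    have near: "dist (f w) (of_nat i) < 1 / 2"
      if "i \<in> {0..N}" "w \<in> (if i = 0 then id else \<phi> i ^^ n) ` K" for i w
      using f[OF that(1)] that(2) K(2) by (auto simp: h_def subset_eq simp del: mem_ball)
    show "disjoint_family_on (\<lambda>i. (if i = 0 then id else \<phi> i ^^ n) ` K) {0..N}"
      unfolding disjoint_family_on_def
    proof (intro ballI impI equals0I, elim IntE)
      fix i j w assume ij: "i \<in> {0..N}" "j \<in> {0..N}" "i \<noteq> j"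
        and w: "w \<in> (if i = 0 then id else \<phi> i ^^ n) ` K" "w \<in> (if j = 0 then id else \<phi> j ^^ n) ` K"
      have "dist (of_nat i :: complex) (of_nat j) < 1"
        using dist_triangle_half_r[of "f w" "of_nat i" 1 "of_nat j"] near[OF ij(1) w(1)] near[OF ij(2) w(2)]
        by simp
      then have "norm (of_int (int i - int j) :: complex) < 1" by (simp add: dist_norm)
      then show False using ij(3) by (simp only: norm_of_int)
    qed
  qed
qed

section \<open>Sufficiency\<close>

lemma disjoint_images_imp_comp_op_transitive:
  assumes F: "furstenberg_family \<F>"
    and hol: "\<And>i. i \<in> {1..N} \<Longrightarrow> \<phi> i holomorphic_on unit_disc"
    and maps: "\<And>i. i \<in> {1..N} \<Longrightarrow> \<phi> i ` unit_disc \<subseteq> unit_disc"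
    and inj: "\<And>i. i \<in> {1..N} \<Longrightarrow> inj_on (\<phi> i) unit_disc"
    and dis: "\<And>K. compact K \<Longrightarrow> K \<subseteq> unit_disc \<Longrightarrow>
      {n \<in> {1..}. disjoint_family_on (\<lambda>i. (if i = 0 then id else \<phi> i ^^ n) ` K) {0..N}} \<in> \<F>"
  shows "disjoint_transitive \<F> hol_disc_topology N (\<lambda>i. comp_op (\<phi> i))"
proof (rule disjoint_transitive_comp_op_iff[OF F hol maps, THEN iffD2], assumption, assumption, intro allI impI)
  fix K and e :: real and h
  assume *: "compact K \<and> K \<subseteq> unit_disc \<and> e > 0 \<and> (\<forall>i\<in>{0..N}. h i \<in> hol_disc)"
  obtain r where r: "0 < r" "r < 1" "K \<subseteq> cball 0 r"
    using compact_subset_ball_subset_cball * by metis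
  \<comment> \<open>The midpoint of \<open>r\<close> and 1. Disjointness is invoked for the larger
    disc \<open>cball 0 s\<close>, which leaves room for the contour around
    \<open>cball 0 r\<close>.\<close>
  define s where "s = (1 + r) / 2"
  have s: "r < s" "s < 1" using r by (auto simp: s_def)
  then have sD: "cball 0 s \<subseteq> unit_disc" by auto
  have "{n \<in> {1..}. disjoint_family_on (\<lambda>i. (if i = 0 then id else \<phi> i ^^ n) ` cball 0 s) {0..N}} \<in> \<F>"
    by (rule dis[OF compact_cball sD])
  then show "{n \<in> {1..}. \<exists>f\<in>hol_disc. \<forall>i\<in>{0..N}. \<forall>z\<in>K.
      dist (f ((if i = 0 then id else \<phi> i ^^ n) z)) (h i z) < e} \<in> \<F>"
  proof (rule furstenberg_family_mono[OF F])
    fix n :: nat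
    define \<psi> where "\<psi> = (\<lambda>i. if i = 0 then id else \<phi> i ^^ n)"
    assume "disjoint_family_on (\<lambda>i. (if i = 0 then id else \<phi> i ^^ n) ` cball 0 s) {0..N}"
    then have disn: "disjoint_family_on (\<lambda>i. \<psi> i ` cball 0 s) {0..N}" by (simp only: \<psi>_def)
    have \<psi>: "\<psi> i holomorphic_on unit_disc \<and> \<psi> i ` unit_disc \<subseteq> unit_disc \<and> inj_on (\<psi> i) unit_disc"
      if "i \<in> {0..N}" for i
    proof (cases "i = 0")
      case False
      then have "i \<in> {1..N}" using that by auto
      then show ?thesis
        using False funpow_self_map[OF hol maps] inj by (simp add: \<psi>_def)
    qed (simp add: \<psi>_def id_def)
    obtain p where p: "p holomorphic_on UNIV"
      "\<And>i u. i \<in> {0..N} \<Longrightarrow> u \<in> cball 0 r \<Longrightarrow> dist (p (\<psi> i u)) (h i u) < e"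
      using simultaneous_entire_approximation[OF finite_atLeastAtMost r(1) s(1) sD open_ball _ _ _ disn,
        where f = h and e = e] \<psi> * unfolding hol_disc_def by blast
    \<comment> \<open>Cutting \<open>p\<close> off outside the disc yields a member of
      \<open>hol_disc\<close> and keeps all relevant values, since each \<open>\<psi> i\<close> maps
      \<open>K\<close> into the disc.\<close>
    define f where "f = (\<lambda>z. if z \<in> unit_disc then p z else 0)"
    have "p holomorphic_on unit_disc" using p(1) by (rule holomorphic_on_subset) simp
    then have "f holomorphic_on unit_disc"
      by (rule holomorphic_transform) (simp add: f_def)
    then have "f \<in> hol_disc" by (simp add: hol_disc_def f_def)
    moreover have "dist (f (\<psi> i z)) (h i z) < e" if "i \<in> {0..N}" "z \<in> K" for i z
    proof -
      have "\<psi> i z \<in> unit_disc" using \<psi>[OF that(1)] that(2) * by blast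
      then have "f (\<psi> i z) = p (\<psi> i z)" by (simp add: f_def)
      then show ?thesis using p(2)[OF that(1)] that(2) r(3) by auto
    qed
    ultimately show "\<exists>f\<in>hol_disc. \<forall>i\<in>{0..N}. \<forall>z\<in>K.
      dist (f ((if i = 0 then id else \<phi> i ^^ n) z)) (h i z) < e"
      unfolding \<psi>_def by blast
  qed
qed

theorem theorem3p3:
  fixes \<F> :: "nat set set" and N :: nat and \<phi> :: "nat \<Rightarrow> complex \<Rightarrow> complex"
  assumes "furstenberg_family \<F>"
    and "N \<ge> 2"
    and "\<And>i. i \<in> {1..N} \<Longrightarrow> \<phi> i holomorphic_on unit_disc"
    and "\<And>i. i \<in> {1..N} \<Longrightarrow> \<phi> i ` unit_disc \<subseteq> unit_disc"
  shows "disjoint_transitive \<F> hol_disc_topology N (\<lambda>i. comp_op (\<phi> i)) \<longleftrightarrow>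
    (\<forall>i\<in>{1..N}. inj_on (\<phi> i) unit_disc) \<and>
    (\<forall>K. compact K \<and> K \<subseteq> unit_disc \<longrightarrow>
       {n \<in> {1..}. disjoint_family_on (\<lambda>i. if i = 0 then K else (\<phi> i ^^ n) ` K) {0..N}} \<in> \<F>)"
proof -
  \<comment> \<open>The set \<open>K\<close> itself becomes the image under \<open>id\<close>,
    matching the form used in the two implications.\<close>
  have image_eq: "(\<lambda>i. if i = 0 then K else (\<phi> i ^^ n) ` K) = (\<lambda>i. (if i = 0 then id else \<phi> i ^^ n) ` K)"
    for K n by (rule ext) simp
  show ?thesis
    unfolding image_eq
  proof (intro iffI conjI ballI allI impI; (elim conjE)?)
    assume trans: "disjoint_transitive \<F> hol_disc_topology N (\<lambda>i. comp_op (\<phi> i))"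
    show "inj_on (\<phi> i) unit_disc" if "i \<in> {1..N}" for i
      using comp_op_transitive_imp_inj_on[OF assms(1) trans] assms(3,4) that by simp
    show "{n \<in> {1..}. disjoint_family_on (\<lambda>i. (if i = 0 then id else \<phi> i ^^ n) ` K) {0..N}} \<in> \<F>"
      if "compact K" "K \<subseteq> unit_disc" for K
      using comp_op_transitive_imp_disjoint_images[OF assms(1) trans] assms(3,4) that by simp
  next
    assume "\<forall>i\<in>{1..N}. inj_on (\<phi> i) unit_disc"
      and "\<forall>K. compact K \<and> K \<subseteq> unit_disc \<longrightarrow>
        {n \<in> {1..}. disjoint_family_on (\<lambda>i. (if i = 0 then id else \<phi> i ^^ n) ` K) {0..N}} \<in> \<F>"
    then show "disjoint_transitive \<F> hol_disc_topology N (\<lambda>i. comp_op (\<phi> i))"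
      using disjoint_images_imp_comp_op_transitive[OF assms(1)] assms(3,4) by simp
  qed
qed

end
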